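(* Let $(G,\sigma)$ be a connected connection graph, with $\sigma$ taking values in $\mathbb{O}(d)$, and let $\lambda>0$. For $\delta\ge0$ and $\alpha,\beta\in\ell(V;\mathbb{R}^d)$ put $$\mathcal{W}_1^{\sigma,\delta,\lambda}(\alpha,\beta)=\inf_{J\in\ell(E';\mathbb{R}^d)}\left\{\sum_{e\in E'}w(e)\|J(e)\|_2+\frac{\lambda}{2}\|J\|_2^2 : \|BJ-(\alpha-\beta)\|_\infty\le\delta\right\}.$$ Given $\alpha,\beta\in\ell(V;\mathbb{R}^d)$, there exists $\delta\ge0$ such that this problem is feasible, equivalently $\mathcal{W}_1^{\sigma,\delta,\lambda}(\alpha,\beta)<\infty$. Moreover, let $P\in\mathbb{R}^{nd\times nd}$ denote the orthogonal projector onto the kernel of the unweighted connection Laplacian $L=BB^\top$, and suppose $\alpha\ne\beta$ and $\|P(\alpha-\beta)\|_\infty<\|\alpha-\beta\|_\infty$. Then there exists $\delta>0$ such that $0<\mathcal{W}_1^{\sigma,\delta,\lambda}(\alpha,\beta)<\infty$.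
   Context: $G=(V,E,w)$ is a finite, connected, weighted, undirected graph with $V=\{1,\dots,n\}$, $n\ge 2$, $E\subseteq\binom{V}{2}$, $|E|=m\ge1$, and symmetric weights $w_{ij}\ge 0$ with $w_{ij}>0$ iff $\{i,j\}\in E$ (written $i\sim j$). The index-oriented edge set is $E'=\{(i,j): i<j,\ i\sim j\}$, and $w(e)=w_{ij}$ for $e=(i,j)\in E'$. $\mathbb{O}(d)$ is the group of $d\times d$ real orthogonal matrices, $d\ge1$. A connection is a map $\sigma:E'\to\mathbb{O}(d)$, written $\sigma_{ij}=\sigma((i,j))$, extended by $\sigma_{ji}=\sigma_{ij}^{-1}=\sigma_{ij}^\top$; the pair $(G,\sigma)$ is a connection graph. $\ell(V;\mathbb{R}^d)$ and $\ell(E';\mathbb{R}^d)$ are the spaces of functions $V\to\mathbb{R}^d$ and $E'\to\mathbb{R}^d$, identified with column vectors in $\mathbb{R}^{nd}$ and $\mathbb{R}^{md}$; $\|\cdot\|_2$ and $\|\cdot\|_\infty$ are the usual norms of these column vectors (and $\|\cdot\|_2$ also denotes the Euclidean norm on $\mathbb{R}^d$). The connection incidence matrix $B\in\mathbb{R}^{nd\times md}$ is the block matrix with $d\times d$ blocks, for $i\in V$, $e\in E'$: $B_{ie}=I_d$ if $e=(i,\cdot)$, $B_{ie}=-\sigma_e^\top$ if $e=(\cdot,i)$, and $B_{ie}=0$ otherwise. The problem is feasible if its constraint set is nonempty; the infimum over the empty set is $+\infty$. *)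

theory Defs
  imports "HOL-Analysis.Analysis"
begin

text \<open>
  The vertex set \<open>V = {1, ..., n}\<close> is the universe of a finite linearly ordered type \<open>'n\<close>, and
  \<open>\<real>\<^sup>d\<close> is \<open>real ^ 'd\<close>.  Elements of \<open>\<ell>(V; \<real>\<^sup>d)\<close> are the column vectors
  \<open>real ^ ('n \<times> 'd)\<close>, the coordinate \<open>(i, k)\<close> being the \<open>k\<close>-th coordinate at the vertex \<open>i\<close>.
\<close>

definition weighted_graph :: "'n set set \<Rightarrow> ('n::finite \<Rightarrow> 'n \<Rightarrow> real) \<Rightarrow> bool" where
  "weighted_graph E w \<longleftrightarrow>
     (\<forall>e\<in>E. card e = 2) \<and>
     (\<forall>i j. w i j = w j i) \<and> (\<forall>i j. 0 \<le> w i j) \<and>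
     (\<forall>i j. 0 < w i j \<longleftrightarrow> {i, j} \<in> E)"

definition connected_graph :: "'n set set \<Rightarrow> bool" where
  "connected_graph E \<longleftrightarrow> (\<forall>i j. (i, j) \<in> {(u, v). {u, v} \<in> E}\<^sup>*)"

definition oriented_edges :: "'n::linorder set set \<Rightarrow> ('n \<times> 'n) set" where
  "oriented_edges E = {(i, j). i < j \<and> {i, j} \<in> E}"

text \<open>Only the values of \<open>\<sigma>\<close> on the oriented edge set are ever used.\<close>

definition connection :: "'n::linorder set set \<Rightarrow> ('n \<times> 'n \<Rightarrow> real ^ 'd ^ 'd) \<Rightarrow> bool" where
  "connection E \<sigma> \<longleftrightarrow> (\<forall>e\<in>oriented_edges E. orthogonal_matrix (\<sigma> e))"

definition value_at :: "real ^ ('a::finite \<times> 'd::finite) \<Rightarrow> 'a \<Rightarrow> real ^ 'd" where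
  "value_at x a = (\<chi> k. x $ (a, k))"

text \<open>
  The oriented edge set \<open>E'\<close> is not a type, so \<open>\<ell>(E'; \<real>\<^sup>d)\<close> is represented by the
  functions on all pairs of vertices that vanish outside \<open>E'\<close>.  Accordingly the incidence matrix
  has additional columns, for the pairs outside \<open>E'\<close>, which are zero; they change neither
  \<open>B J\<close> nor \<open>B B\<^sup>T\<close>.
\<close>

definition edge_functions ::
    "'n::{finite,linorder} set set \<Rightarrow> (real ^ (('n \<times> 'n) \<times> 'd::finite)) set" where
  "edge_functions E = {J. \<forall>e. e \<notin> oriented_edges E \<longrightarrow> value_at J e = 0}"

definition incidence_block ::
    "'n::linorder set set \<Rightarrow> ('n \<times> 'n \<Rightarrow> real ^ 'd ^ 'd) \<Rightarrow> 'n \<Rightarrow> 'n \<times> 'n \<Rightarrow> real ^ 'd ^ 'd" where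
  "incidence_block E \<sigma> i e =
     (if e \<in> oriented_edges E \<and> fst e = i then mat 1
      else if e \<in> oriented_edges E \<and> snd e = i then - transpose (\<sigma> e)
      else 0)"

definition incidence_matrix ::
    "'n::{finite,linorder} set set \<Rightarrow> ('n \<times> 'n \<Rightarrow> real ^ 'd ^ 'd) \<Rightarrow>
     real ^ (('n \<times> 'n) \<times> 'd::finite) ^ ('n \<times> 'd)" where
  "incidence_matrix E \<sigma> =
     (\<chi> p q. incidence_block E \<sigma> (fst p) (fst q) $ snd p $ snd q)"

definition connection_laplacian ::
    "'n::{finite,linorder} set set \<Rightarrow> ('n \<times> 'n \<Rightarrow> real ^ 'd ^ 'd) \<Rightarrow>
     real ^ ('n \<times> 'd::finite) ^ ('n \<times> 'd)" where
  "connection_laplacian E \<sigma> = incidence_matrix E \<sigma> ** transpose (incidence_matrix E \<sigma>)"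

definition orthogonal_projector_onto :: "real ^ 'a ^ 'a \<Rightarrow> (real ^ 'a) set \<Rightarrow> bool" where
  "orthogonal_projector_onto P S \<longleftrightarrow>
     P ** P = P \<and> transpose P = P \<and> range (\<lambda>x. P *v x) = S"

definition feasible_set ::
    "'n::{finite,linorder} set set \<Rightarrow> ('n \<times> 'n \<Rightarrow> real ^ 'd ^ 'd) \<Rightarrow> real \<Rightarrow>
     real ^ ('n \<times> 'd::finite) \<Rightarrow> real ^ ('n \<times> 'd) \<Rightarrow> (real ^ (('n \<times> 'n) \<times> 'd)) set" where
  "feasible_set E \<sigma> \<delta> \<alpha> \<beta> =
     {J \<in> edge_functions E. infnorm (incidence_matrix E \<sigma> *v J - (\<alpha> - \<beta>)) \<le> \<delta>}"

definition transport_cost ::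
    "'n::{finite,linorder} set set \<Rightarrow> ('n \<Rightarrow> 'n \<Rightarrow> real) \<Rightarrow> real \<Rightarrow>
     real ^ (('n \<times> 'n) \<times> 'd::finite) \<Rightarrow> real" where
  "transport_cost E w lambda J =
     (\<Sum>(i, j)\<in>oriented_edges E. w i j * norm (value_at J (i, j))) + lambda / 2 * (norm J)\<^sup>2"

text \<open>The value is an extended real, so that the infimum over the empty set is \<open>\<infinity>\<close>.\<close>

definition connection_W1 ::
    "'n::{finite,linorder} set set \<Rightarrow> ('n \<Rightarrow> 'n \<Rightarrow> real) \<Rightarrow> ('n \<times> 'n \<Rightarrow> real ^ 'd ^ 'd) \<Rightarrow>
     real \<Rightarrow> real \<Rightarrow> real ^ ('n \<times> 'd::finite) \<Rightarrow> real ^ ('n \<times> 'd) \<Rightarrow> ereal" where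
  "connection_W1 E w \<sigma> \<delta> lambda \<alpha> \<beta> =
     (INF J\<in>feasible_set E \<sigma> \<delta> \<alpha> \<beta>. ereal (transport_cost E w lambda J))"

end

theory Submission
  imports Defs
begin

text \<open>
  Write \<open>v = \<alpha> - \<beta>\<close>.  Since \<open>v - P v\<close> is orthogonal to \<open>ker L\<close> and \<open>L = B B\<^sup>T\<close> is symmetric,
  \<open>v - P v = L y = B (B\<^sup>T y)\<close> for some \<open>y\<close>, so the problem is feasible for every
  \<open>\<delta> \<ge> \<parallel>P v\<parallel>\<^sub>\<infinity>\<close>.  If moreover \<open>\<delta> < \<parallel>v\<parallel>\<^sub>\<infinity>\<close>, then \<open>\<parallel>B J\<parallel>\<^sub>\<infinity> \<ge> \<parallel>v\<parallel>\<^sub>\<infinity> - \<delta> > 0\<close> for every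
  feasible \<open>J\<close>, which bounds \<open>\<parallel>J\<parallel>\<^sub>2\<close>, and hence the quadratic part of the cost, away from zero.
\<close>

text \<open>Split \<open>v - P *v v\<close> along the range of \<open>L\<close>. For symmetric
  \<open>L\<close> the component orthogonal to that range lies in \<open>ker L\<close>, the range of
  \<open>P\<close>; but \<open>v - P *v v\<close> is orthogonal to the range of \<open>P\<close>, so
  this component vanishes.\<close>

lemma orthogonal_projector_symmetric_kernel_complement:
  fixes L P :: "real ^ 'a ^ 'a::finite"
  assumes L: "transpose L = L"
    and P: "orthogonal_projector_onto P {x. L *v x = 0}"
  shows "\<exists>y. L *v y = v - P *v v"
proof -
  have PP: "P ** P = P" and Pt: "transpose P = P" and ran: "range ((*v) P) = {x. L *v x = 0}"
    using P by (auto simp: orthogonal_projector_onto_def)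
  have self_adjoint: "(A *v x) \<bullet> y = x \<bullet> (A *v y)" if "transpose A = A" for A :: "real ^ 'a ^ 'a" and x y
    using dot_lmul_matrix[of x A y] that by (metis transpose_matrix_vector)
  obtain a b where a: "a \<in> span (range ((*v) L))"
    and b: "\<And>u. u \<in> span (range ((*v) L)) \<Longrightarrow> orthogonal b u"
    and ab: "v - P *v v = a + b"
    by (meson orthogonal_subspace_decomp_exists)
  have "(L *v b) \<bullet> (L *v b) = b \<bullet> (L *v (L *v b))"
    by (rule self_adjoint[OF L])
  also have "\<dots> = 0"
    using b[of "L *v (L *v b)"] by (auto simp: orthogonal_def span_base)
  finally have "b \<in> range ((*v) P)"
    by (simp add: ran)
  then obtain z where z: "b = P *v z"
    by auto
  \<comment> \<open>Moving \<open>P\<close> across the inner product leaves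
    \<open>P *v v - P *v (P *v v)\<close>, which is zero by idempotence.\<close>
  have "b \<bullet> (v - P *v v) = z \<bullet> (P *v (v - P *v v))"
    by (simp add: z self_adjoint[OF Pt])
  also have "\<dots> = 0"
    by (simp add: matrix_vector_mult_diff_distrib matrix_vector_mul_assoc PP)
  finally have "b \<bullet> b = 0"
    using b[OF a] by (simp add: ab inner_add_right orthogonal_def)
  then have "v - P *v v \<in> span (range ((*v) L))"
    using a ab by simp
  then show ?thesis
    by (auto simp: span_eq_iff[THEN iffD2] linear_subspace_image)
qed

text \<open>The padded columns of the incidence matrix, for pairs outside
  \<open>oriented_edges E\<close>, are zero. This makes \<open>B\<^sup>T y\<close> an admissible
  flow.\<close>

lemma transpose_incidence_in_edge_functions:
  "transpose (incidence_matrix E \<sigma>) *v y \<in> edge_functions E"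
  by (auto simp: edge_functions_def value_at_def vec_eq_iff matrix_vector_mult_def transpose_def
      incidence_matrix_def incidence_block_def intro!: sum.neutral)

text \<open>Each individual cost is a real number, so the infimum is infinite only over the empty
  set.\<close>

lemma connection_W1_less_infinity_iff:
  "connection_W1 E w \<sigma> \<delta> lambda \<alpha> \<beta> < \<infinity> \<longleftrightarrow> feasible_set E \<sigma> \<delta> \<alpha> \<beta> \<noteq> {}"
  unfolding connection_W1_def INF_less_iff by auto

lemma zero_in_feasible_set:
  "infnorm (\<alpha> - \<beta>) \<le> \<delta> \<Longrightarrow> 0 \<in> feasible_set E \<sigma> \<delta> \<alpha> \<beta>"
  by (simp add: feasible_set_def edge_functions_def value_at_def vec_eq_iff infnorm_sub)

lemma feasible_set_nonempty:
  assumes P: "orthogonal_projector_onto P {x. connection_laplacian E \<sigma> *v x = 0}"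
    and "infnorm (P *v (\<alpha> - \<beta>)) \<le> \<delta>"
  shows "feasible_set E \<sigma> \<delta> \<alpha> \<beta> \<noteq> {}"
proof -
  have "transpose (connection_laplacian E \<sigma>) = connection_laplacian E \<sigma>"
    by (simp add: connection_laplacian_def matrix_transpose_mul)
  from orthogonal_projector_symmetric_kernel_complement[OF this P]
  obtain y where "connection_laplacian E \<sigma> *v y = (\<alpha> - \<beta>) - P *v (\<alpha> - \<beta>)"
    by blast
  \<comment> \<open>The flow \<open>B\<^sup>T y\<close> misses the target by exactly the kernel
    component. The deleted simp rule would turn \<open>B\<^sup>T y\<close> into a row-vector product
    and block reassociation to \<open>L y\<close>.\<close>
  then have "incidence_matrix E \<sigma> *v (transpose (incidence_matrix E \<sigma>) *v y) - (\<alpha> - \<beta>)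
      = - (P *v (\<alpha> - \<beta>))"
    by (simp add: connection_laplacian_def matrix_vector_mul_assoc del: transpose_matrix_vector)
  then have "transpose (incidence_matrix E \<sigma>) *v y \<in> feasible_set E \<sigma> \<delta> \<alpha> \<beta>"
    using assms(2) transpose_incidence_in_edge_functions[of E \<sigma> y]
    by (simp add: feasible_set_def infnorm_neg)
  then show ?thesis
    by blast
qed

lemma transport_cost_ge:
  assumes "\<And>i j. 0 \<le> w i j"
  shows "lambda / 2 * (norm J)\<^sup>2 \<le> transport_cost E w lambda J"
  unfolding transport_cost_def by (auto intro!: sum_nonneg simp: assms)

lemma connection_W1_pos:
  fixes \<alpha> \<beta> :: "real ^ ('n::{finite,linorder} \<times> 'd::finite)"
  assumes w: "\<And>i j. 0 \<le> w i j" and lambda: "0 < lambda" and \<delta>: "\<delta> < infnorm (\<alpha> - \<beta>)"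
  shows "0 < connection_W1 E w \<sigma> \<delta> lambda \<alpha> \<beta>"
proof -
  let ?B = "incidence_matrix E \<sigma>"
  obtain C where C: "0 < C" "\<And>J. norm (?B *v J) \<le> norm J * C"
    using bounded_linear.pos_bounded[OF matrix_vector_mul_bounded_linear] by blast
  \<comment> \<open>A feasible \<open>J\<close> satisfies \<open>infnorm (\<alpha> - \<beta>) -
    \<delta> \<le> infnorm (?B *v J) \<le> norm J * C\<close>, so \<open>c\<close> bounds
    \<open>norm J\<close> from below.\<close>
  define c where "c = (infnorm (\<alpha> - \<beta>) - \<delta>) / C"
  have c: "0 < c"
    using C \<delta> by (simp add: c_def)
  have "ereal (lambda / 2 * c\<^sup>2) \<le> ereal (transport_cost E w lambda J)"
    if J: "J \<in> feasible_set E \<sigma> \<delta> \<alpha> \<beta>" for J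
  proof -
    have "infnorm (\<alpha> - \<beta>) \<le> infnorm (?B *v J) + infnorm (?B *v J - (\<alpha> - \<beta>))"
      using infnorm_triangle[of "?B *v J" "- (?B *v J - (\<alpha> - \<beta>))"]
      unfolding infnorm_neg by simp
    also have "\<dots> \<le> norm J * C + \<delta>"
      using J C(2)[of J] infnorm_le_norm[of "?B *v J"] by (simp add: feasible_set_def)
    finally have "c \<le> norm J"
      using C(1) by (simp add: c_def pos_divide_le_eq)
    then have "lambda / 2 * c\<^sup>2 \<le> lambda / 2 * (norm J)\<^sup>2"
      using c lambda by (intro mult_left_mono power_mono) auto
    also have "\<dots> \<le> transport_cost E w lambda J"
      by (rule transport_cost_ge[OF w])
    finally show ?thesis
      by simp
  qed
  \<comment> \<open>Since \<open>c\<close> does not depend on \<open>J\<close>, the bound survives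
    the infimum; positivity of each cost alone would not.\<close>
  then have "ereal (lambda / 2 * c\<^sup>2) \<le> connection_W1 E w \<sigma> \<delta> lambda \<alpha> \<beta>"
    unfolding connection_W1_def by (rule INF_greatest)
  moreover have "0 < ereal (lambda / 2 * c\<^sup>2)"
    using c lambda by simp
  ultimately show ?thesis
    by (rule less_le_trans[rotated])
qed

theorem lemma3p2:
  fixes E :: "'n::{finite,linorder} set set"
    and w :: "'n \<Rightarrow> 'n \<Rightarrow> real"
    and \<sigma> :: "'n \<times> 'n \<Rightarrow> real ^ 'd::finite ^ 'd"
    and lambda :: real
    and \<alpha> \<beta> :: "real ^ ('n \<times> 'd)"
  assumes "2 \<le> CARD('n)"
    and "1 \<le> card E"
    and "weighted_graph E w"
    and "connected_graph E"
    and "connection E \<sigma>"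
    and "0 < lambda"
  shows "(\<forall>\<delta>\<ge>0. feasible_set E \<sigma> \<delta> \<alpha> \<beta> \<noteq> {} \<longleftrightarrow> connection_W1 E w \<sigma> \<delta> lambda \<alpha> \<beta> < \<infinity>) \<and>
    (\<exists>\<delta>\<ge>0. feasible_set E \<sigma> \<delta> \<alpha> \<beta> \<noteq> {} \<and> connection_W1 E w \<sigma> \<delta> lambda \<alpha> \<beta> < \<infinity>) \<and>
    (\<forall>P :: real ^ ('n \<times> 'd) ^ ('n \<times> 'd).
      orthogonal_projector_onto P {x. connection_laplacian E \<sigma> *v x = 0} \<longrightarrow>
      \<alpha> \<noteq> \<beta> \<longrightarrow>
      infnorm (P *v (\<alpha> - \<beta>)) < infnorm (\<alpha> - \<beta>) \<longrightarrow>
      (\<exists>\<delta>>0. 0 < connection_W1 E w \<sigma> \<delta> lambda \<alpha> \<beta> \<and> connection_W1 E w \<sigma> \<delta> lambda \<alpha> \<beta> < \<infinity>))"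
proof (intro conjI allI impI)
  show "feasible_set E \<sigma> \<delta> \<alpha> \<beta> \<noteq> {} \<longleftrightarrow> connection_W1 E w \<sigma> \<delta> lambda \<alpha> \<beta> < \<infinity>" for \<delta>
    by (simp only: connection_W1_less_infinity_iff)
  \<comment> \<open>Take \<open>\<delta> = infnorm (\<alpha> - \<beta>)\<close>, for which the zero
    flow is feasible.\<close>
  show "\<exists>\<delta>\<ge>0. feasible_set E \<sigma> \<delta> \<alpha> \<beta> \<noteq> {} \<and> connection_W1 E w \<sigma> \<delta> lambda \<alpha> \<beta> < \<infinity>"
    using zero_in_feasible_set[OF order_refl] infnorm_pos_le[of "\<alpha> - \<beta>"]
    unfolding connection_W1_less_infinity_iff by blast
next
  fix P :: "real ^ ('n \<times> 'd) ^ ('n \<times> 'd)"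
  assume P: "orthogonal_projector_onto P {x. connection_laplacian E \<sigma> *v x = 0}"
    and less: "infnorm (P *v (\<alpha> - \<beta>)) < infnorm (\<alpha> - \<beta>)"
  \<comment> \<open>The lower bound on \<delta> gives feasibility and \<open>0 < \<delta>\<close>;
    the upper bound excludes the zero flow and gives a positive value.\<close>
  obtain \<delta> where \<delta>: "infnorm (P *v (\<alpha> - \<beta>)) < \<delta>" "\<delta> < infnorm (\<alpha> - \<beta>)"
    using dense[OF less] by blast
  have "0 < \<delta>"
    using \<delta>(1) infnorm_pos_le by (rule le_less_trans[rotated])
  moreover have "0 < connection_W1 E w \<sigma> \<delta> lambda \<alpha> \<beta>"
    using assms \<delta>(2) by (intro connection_W1_pos) (auto simp: weighted_graph_def)
  moreover have "connection_W1 E w \<sigma> \<delta> lambda \<alpha> \<beta> < \<infinity>"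
    unfolding connection_W1_less_infinity_iff
    using feasible_set_nonempty[OF P] \<delta>(1) by simp
  ultimately show "\<exists>\<delta>>0. 0 < connection_W1 E w \<sigma> \<delta> lambda \<alpha> \<beta> \<and> connection_W1 E w \<sigma> \<delta> lambda \<alpha> \<beta> < \<infinity>"
    by blast
qed

end
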